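(* Let $n\ge 1$. For formulas $D_1,\dots,D_n,C$ define $U_1:=\Diamond\neg(D_1\rhd\neg C)$ and $U_{k+1}:=\Diamond\big((D_k\rhd D_{k+1})\wedge U_k\big)$, and let $\mathsf R^n$ be the scheme $$A\rhd B\to \big(U_n\wedge(D_n\rhd A)\big)\rhd (B\wedge\Box C)$$ (all instances with arbitrary formulas $A,B,C,D_1,\dots,D_n$). Let $(\mathsf R^n)_{gen}$ be the following condition on a generalised Veltman frame $\langle W,R,\{S_w\}\rangle$: for all worlds $w,x_1,\dots,x_n,y,z$ and all sets $\mathbb A,\mathbb B,\mathbb C,\mathbb D_1,\dots,\mathbb D_n\subseteq W$, if (i) $wRx_nRx_{n-1}R\cdots Rx_1RyRz$; (ii) for all $u$, if $wRu$ and $u\in\mathbb A$ then there is $V$ with $uS_wV$ and $V\subseteq\mathbb B$; (iii) for all $u$, if $x_nRu$ and $u\in\mathbb D_n$ then there is $V$ with $uS_{x_n}V$ and $V\subseteq\mathbb A$; (iv) for each $i\in\{1,\dots,n-1\}$ and all $u$, if $x_iRu$ and $u\in\mathbb D_i$ then there is $V$ with $uS_{x_i}V$ and $V\subseteq\mathbb D_{i+1}$; (v) for all $V$, if $zS_yV$ then $V\cap\mathbb C\neq\emptyset$; (vi) $z\in\mathbb D_1$; then there is $V\subseteq\mathbb B$ with $x_nS_wV$ and $\{t:\exists v\in V\ vRt\}\subseteq\mathbb C$. Then for every generalised Veltman frame $\mathfrak F$: $\mathfrak F$ satisfies $(\mathsf R^n)_{gen}$ if and only if every instance of $\mathsf R^n$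 is forced at every world of every generalised Veltman model based on $\mathfrak F$.
   Context: Formulas are built from propositional variables and $\bot$ using $\to$ (other Boolean connectives defined as usual), $\Box$ and binary $\rhd$; $\Diamond A:=\neg\Box\neg A$. A generalised Veltman frame is $\langle W,R,\{S_w:w\in W\}\rangle$ with $W\neq\emptyset$, $R$ transitive and conversely well-founded, and for each $w$, with $R[w]=\{v:wRv\}$: $S_w\subseteq R[w]\times(\mathcal P(R[w])\setminus\{\emptyset\})$; $wRu$ implies $uS_w\{u\}$; if $uS_wV$ and $vS_wZ_v$ for all $v\in V$ then $uS_w\bigcup_{v\in V}Z_v$; $wRuRv$ implies $uS_w\{v\}$; if $uS_wV$ and $V\subseteq Z\subseteq R[w]$ then $uS_wZ$. A model on the frame adds a valuation of propositional variables as subsets of $W$. Forcing is classical for Boolean connectives, $w\Vdash\Box A$ iff all $R$-successors of $w$ force $A$, and $w\Vdash A\rhd B$ iff for every $u$ with $wRu$ and $u\Vdash A$ there is $V$ with $uS_wV$ and every element of $V$ forcing $B$. *)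

theory Defs imports Main begin

datatype form =
    Var nat
  | Bot  (\<open>\<^bold>\<bottom>\<close>)
  | Imp form form  (infixr \<open>\<^bold>\<rightarrow>\<close> 55)
  | Box form  (\<open>\<^bold>\<box>_\<close> [80] 80)
  | Rhd form form  (infix \<open>\<^bold>\<rhd>\<close> 60)

definition Neg :: "form \<Rightarrow> form"  (\<open>\<^bold>\<not>_\<close> [80] 80)
  where "\<^bold>\<not>A = (A \<^bold>\<rightarrow> \<^bold>\<bottom>)"

definition Conj :: "form \<Rightarrow> form \<Rightarrow> form"  (infixr \<open>\<^bold>\<and>\<close> 70)
  where "A \<^bold>\<and> B = \<^bold>\<not>(A \<^bold>\<rightarrow> \<^bold>\<not>B)"

definition Dia :: "form \<Rightarrow> form"  (\<open>\<^bold>\<diamond>_\<close> [80] 80)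
  where "\<^bold>\<diamond>A = \<^bold>\<not>(\<^bold>\<box>(\<^bold>\<not>A))"

locale generalised_Veltman_frame =
  fixes W :: "'w set"
    and R :: "('w \<times> 'w) set"
    and S :: "'w \<Rightarrow> ('w \<times> 'w set) set"
  assumes nonempty: "W \<noteq> {}"
    and R_worlds: "R \<subseteq> W \<times> W"
    and R_trans: "trans R"
    and R_converse_wf: "wf (R\<inverse>)"
    and S_subset: "w \<in> W \<Longrightarrow> S w \<subseteq> (R `` {w}) \<times> (Pow (R `` {w}) - {{}})"
    and S_quasi_refl: "w \<in> W \<Longrightarrow> (w, u) \<in> R \<Longrightarrow> (u, {u}) \<in> S w"
    and S_quasi_trans: "w \<in> W \<Longrightarrow> (u, V) \<in> S w \<Longrightarrow> (\<forall>v\<in>V. (v, Z v) \<in> S w) \<Longrightarrow>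
      (u, \<Union>v\<in>V. Z v) \<in> S w"
    and S_R: "w \<in> W \<Longrightarrow> (w, u) \<in> R \<Longrightarrow> (u, v) \<in> R \<Longrightarrow> (u, {v}) \<in> S w"
    and S_mono: "w \<in> W \<Longrightarrow> (u, V) \<in> S w \<Longrightarrow> V \<subseteq> V' \<Longrightarrow> V' \<subseteq> R `` {w} \<Longrightarrow> (u, V') \<in> S w"

primrec forces ::
  "('w \<times> 'w) set \<Rightarrow> ('w \<Rightarrow> ('w \<times> 'w set) set) \<Rightarrow> (nat \<Rightarrow> 'w set) \<Rightarrow> 'w \<Rightarrow> form \<Rightarrow> bool"
where
  "forces R S val w (Var p) \<longleftrightarrow> w \<in> val p"
| "forces R S val w \<^bold>\<bottom> \<longleftrightarrow> False"
| "forces R S val w (A \<^bold>\<rightarrow> B) \<longleftrightarrow> (forces R S val w A \<longrightarrow> forces R S val w B)"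
| "forces R S val w (\<^bold>\<box>A) \<longleftrightarrow> (\<forall>v. (w, v) \<in> R \<longrightarrow> forces R S val v A)"
| "forces R S val w (A \<^bold>\<rhd> B) \<longleftrightarrow>
    (\<forall>u. (w, u) \<in> R \<and> forces R S val u A \<longrightarrow>
      (\<exists>V. (u, V) \<in> S w \<and> (\<forall>v\<in>V. forces R S val v B)))"

definition frame_valid ::
  "'w set \<Rightarrow> ('w \<times> 'w) set \<Rightarrow> ('w \<Rightarrow> ('w \<times> 'w set) set) \<Rightarrow> form \<Rightarrow> bool"
where
  "frame_valid W R S A \<longleftrightarrow>
    (\<forall>val. (\<forall>p. val p \<subseteq> W) \<longrightarrow> (\<forall>w\<in>W. forces R S val w A))"

text \<open>Families such as \<open>D\<^sub>1, \<dots>, D\<^sub>n\<close> are functions on \<^typ>\<open>nat\<close> of which only the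
  values at \<open>1, \<dots>, n\<close> are used; the value of \<open>U\<close> at \<open>0\<close> is a dummy.\<close>

fun U :: "(nat \<Rightarrow> form) \<Rightarrow> form \<Rightarrow> nat \<Rightarrow> form" where
  "U D C 0 = \<^bold>\<bottom>"
| "U D C (Suc 0) = \<^bold>\<diamond>(\<^bold>\<not>(D 1 \<^bold>\<rhd> \<^bold>\<not>C))"
| "U D C (Suc (Suc k)) = \<^bold>\<diamond>((D (Suc k) \<^bold>\<rhd> D (Suc (Suc k))) \<^bold>\<and> U D C (Suc k))"

definition R_scheme :: "nat \<Rightarrow> form \<Rightarrow> form \<Rightarrow> form \<Rightarrow> (nat \<Rightarrow> form) \<Rightarrow> form" where
  "R_scheme n A B C D =
    ((A \<^bold>\<rhd> B) \<^bold>\<rightarrow> ((U D C n \<^bold>\<and> (D n \<^bold>\<rhd> A)) \<^bold>\<rhd> (B \<^bold>\<and> \<^bold>\<box>C)))"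

definition R_gen ::
  "nat \<Rightarrow> 'w set \<Rightarrow> ('w \<times> 'w) set \<Rightarrow> ('w \<Rightarrow> ('w \<times> 'w set) set) \<Rightarrow> bool"
where
  "R_gen n W R S \<longleftrightarrow>
    (\<forall>w\<in>W. \<forall>x. (\<forall>i\<in>{1..n}. x i \<in> W) \<longrightarrow> (\<forall>y\<in>W. \<forall>z\<in>W.
     \<forall>\<A> \<B> \<C> \<D>. \<A> \<subseteq> W \<and> \<B> \<subseteq> W \<and> \<C> \<subseteq> W \<and> (\<forall>i\<in>{1..n}. \<D> i \<subseteq> W) \<longrightarrow>
      (w, x n) \<in> R \<and> (\<forall>i\<in>{1..<n}. (x (Suc i), x i) \<in> R) \<and> (x 1, y) \<in> R \<and> (y, z) \<in> R \<longrightarrow>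
      (\<forall>u. (w, u) \<in> R \<and> u \<in> \<A> \<longrightarrow> (\<exists>V. (u, V) \<in> S w \<and> V \<subseteq> \<B>)) \<longrightarrow>
      (\<forall>u. (x n, u) \<in> R \<and> u \<in> \<D> n \<longrightarrow> (\<exists>V. (u, V) \<in> S (x n) \<and> V \<subseteq> \<A>)) \<longrightarrow>
      (\<forall>i\<in>{1..<n}. \<forall>u. (x i, u) \<in> R \<and> u \<in> \<D> i \<longrightarrow>
        (\<exists>V. (u, V) \<in> S (x i) \<and> V \<subseteq> \<D> (Suc i))) \<longrightarrow>
      (\<forall>V. (z, V) \<in> S y \<longrightarrow> V \<inter> \<C> \<noteq> {}) \<longrightarrow>
      z \<in> \<D> 1 \<longrightarrow>
      (\<exists>V. V \<subseteq> \<B> \<and> (x n, V) \<in> S w \<and> {t. \<exists>v\<in>V. (v, t) \<in> R} \<subseteq> \<C>)))"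

end

theory Submission imports Defs begin

text \<open>Unfolding \<open>U\<^sub>n\<close> at a world \<open>x\<^sub>n\<close> yields exactly the chain \<open>x\<^sub>n, \<dots>, x\<^sub>1, y, z\<close> of the
  frame condition. Hence the condition implies the scheme by instantiating its sets with the
  truth sets of the formulas, and the scheme implies the condition by evaluating it at distinct
  variables that name the given sets.\<close>

lemma forces_Neg [simp]: "forces R S val w (\<^bold>\<not>A) \<longleftrightarrow> \<not> forces R S val w A"
  by (simp add: Neg_def)

lemma forces_Conj [simp]:
  "forces R S val w (A \<^bold>\<and> B) \<longleftrightarrow> forces R S val w A \<and> forces R S val w B"
  by (simp add: Conj_def)

lemma forces_Dia [simp]:
  "forces R S val w (\<^bold>\<diamond>A) \<longleftrightarrow> (\<exists>v. (w, v) \<in> R \<and> forces R S val v A)"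
  by (simp add: Dia_def)

text \<open>Flattens the nested diamonds of \<open>U D C n\<close> into a single chain, so that
  \<open>x\<close>, \<open>y\<close>, \<open>z\<close> can be handed directly to
  \<open>R_gen\<close>. The last two conditions on \<open>z\<close> say that it refutes
  \<open>D 1 \<rhd> Neg C\<close> at \<open>y\<close>. The world at which \<open>U D C n\<close> is
  evaluated is \<open>x n\<close>.\<close>

definition U_witness ::
  "('w \<times> 'w) set \<Rightarrow> ('w \<Rightarrow> ('w \<times> 'w set) set) \<Rightarrow> (nat \<Rightarrow> 'w set) \<Rightarrow> (nat \<Rightarrow> form) \<Rightarrow> form \<Rightarrow>
    nat \<Rightarrow> (nat \<Rightarrow> 'w) \<Rightarrow> 'w \<Rightarrow> 'w \<Rightarrow> bool"
where
  "U_witness R S val D C n x y z \<longleftrightarrow>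
    (\<forall>i\<in>{1..<n}. (x (Suc i), x i) \<in> R \<and> forces R S val (x i) (D i \<^bold>\<rhd> D (Suc i))) \<and>
    (x 1, y) \<in> R \<and> (y, z) \<in> R \<and> forces R S val z (D 1) \<and>
    (\<forall>V. (z, V) \<in> S y \<longrightarrow> (\<exists>v\<in>V. forces R S val v C))"

text \<open>Only the values of \<open>x\<close> at \<open>1, ..., n\<close> occur, so a chain can be
  prolonged by overwriting \<open>x\<close> at \<open>Suc n\<close>.\<close>

lemma U_witness_cong:
  assumes "n \<ge> 1" and "\<And>i. i \<in> {1..n} \<Longrightarrow> x i = x' i"
  shows "U_witness R S val D C n x y z \<longleftrightarrow> U_witness R S val D C n x' y z"
  using assms unfolding U_witness_def by (simp del: forces.simps)

lemma U_witness_Suc: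
  assumes "n \<ge> 1"
  shows "U_witness R S val D C (Suc n) x y z \<longleftrightarrow>
    (x (Suc n), x n) \<in> R \<and> forces R S val (x n) (D n \<^bold>\<rhd> D (Suc n)) \<and>
    U_witness R S val D C n x y z"
  using assms by (auto simp add: U_witness_def atLeastLessThanSuc simp del: forces.simps)

text \<open>Induction peels off the outermost diamond: the successor that it provides is the top
  \<open>x n\<close> of the shorter chain, and \<open>a\<close> becomes
  \<open>x (Suc n)\<close>.\<close>

lemma forces_U:
  assumes "n \<ge> 1"
  shows "forces R S val a (U D C n) \<longleftrightarrow> (\<exists>x y z. x n = a \<and> U_witness R S val D C n x y z)"
  using assms
proof (induction n arbitrary: a rule: nat_induct_at_least)
  case base
  show ?case
    \<comment> \<open>For \<open>n = 1\<close> the chain has the single entry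
      \<open>x 1 = a\<close>, so a constant function serves.\<close>
    by (auto simp: U_witness_def intro: exI[of _ "\<lambda>_. a"])
next
  case (Suc n)
  then have "U D C (Suc n) = \<^bold>\<diamond>((D n \<^bold>\<rhd> D (Suc n)) \<^bold>\<and> U D C n)"
    \<comment> \<open>The recursive equation of \<open>U\<close> matches only indices of the form
      \<open>Suc (Suc k)\<close>; \<open>n \<ge> 1\<close> brings \<open>Suc n\<close> into this
      form.\<close>
    by (cases n) auto
  then have "forces R S val a (U D C (Suc n)) \<longleftrightarrow>
      (\<exists>x y z. (a, x n) \<in> R \<and> forces R S val (x n) (D n \<^bold>\<rhd> D (Suc n)) \<and>
        U_witness R S val D C n x y z)"
    using Suc.IH by (auto simp del: forces.simps)
  also have "\<dots> \<longleftrightarrow> (\<exists>x y z. x (Suc n) = a \<and> U_witness R S val D C (Suc n) x y z)"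
    (is "?L \<longleftrightarrow> ?R")
  proof
    assume ?L
    then obtain x y z where x: "(a, x n) \<in> R" "forces R S val (x n) (D n \<^bold>\<rhd> D (Suc n))"
      "U_witness R S val D C n x y z"
      by blast
    let ?x = "x(Suc n := a)"
    have "U_witness R S val D C n ?x y z"
      using x(3) U_witness_cong[of n x ?x] Suc.hyps by simp
    then have "U_witness R S val D C (Suc n) ?x y z"
      using x(1,2) Suc.hyps by (simp add: U_witness_Suc del: forces.simps)
    moreover have "?x (Suc n) = a"
      by simp
    ultimately show ?R
      by blast
  next
    assume ?R
    then show ?L
      using Suc.hyps by (auto simp: U_witness_Suc simp del: forces.simps)
  qed
  finally show ?case .
qed

context generalised_Veltman_frame
begin

lemma S_worlds:
  assumes "w \<in> W" "(u, V) \<in> S w"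
  shows "V \<subseteq> W"
  using S_subset[OF assms(1)] assms(2) R_worlds by blast

lemma R_gen_sound:
  assumes "n \<ge> 1" and gen: "R_gen n W R S"
  shows "frame_valid W R S (R_scheme n A B C D)"
  unfolding frame_valid_def
proof (intro allI impI ballI)
  fix val w
  assume w: "w \<in> W"
  \<comment> \<open>Truth sets are cut down to \<open>W\<close> because \<open>forces\<close> is
    defined on the whole type, while \<open>R_gen\<close> ranges over subsets of
    \<open>W\<close>.\<close>
  define T where "T = (\<lambda>E. {v \<in> W. forces R S val v E})"
  have T_sub: "T E \<subseteq> W" for E
    by (auto simp: T_def)
  \<comment> \<open>The common shape of hypotheses (ii), (iii) and (iv), read off from a forced
    \<open>\<rhd>\<close>; \<open>S_worlds\<close> absorbs the restriction to
    \<open>W\<close>.\<close>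
  have rhd: "\<forall>u. (a, u) \<in> R \<and> u \<in> T E \<longrightarrow> (\<exists>V. (u, V) \<in> S a \<and> V \<subseteq> T F)"
    if a: "a \<in> W" and EF: "forces R S val a (E \<^bold>\<rhd> F)" for a E F
  proof (intro allI impI)
    fix u
    assume "(a, u) \<in> R \<and> u \<in> T E"
    then obtain V where "(u, V) \<in> S a" "\<forall>v\<in>V. forces R S val v F"
      using EF by (auto simp: T_def)
    then show "\<exists>V. (u, V) \<in> S a \<and> V \<subseteq> T F"
      using S_worlds[OF a] by (fastforce simp: T_def)
  qed
  have "\<exists>V. (a, V) \<in> S w \<and> (\<forall>v\<in>V. forces R S val v (B \<^bold>\<and> \<^bold>\<box>C))"
    if AB: "forces R S val w (A \<^bold>\<rhd> B)" and wa: "(w, a) \<in> R"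
      and Ua: "forces R S val a (U D C n)" and DA: "forces R S val a (D n \<^bold>\<rhd> A)" for a
  proof -
    obtain x y z where a: "x n = a" and wit: "U_witness R S val D C n x y z"
      using Ua forces_U[OF \<open>n \<ge> 1\<close>] by metis
    have chain: "\<forall>i\<in>{1..<n}. (x (Suc i), x i) \<in> R" "(x 1, y) \<in> R" "(y, z) \<in> R"
      using wit unfolding U_witness_def by auto
    have yz: "y \<in> W" "z \<in> W"
      using chain R_worlds by auto
    have xW: "\<forall>i\<in>{1..n}. x i \<in> W"
    proof
      fix i
      assume "i \<in> {1..n}"
      then show "x i \<in> W"
        \<comment> \<open>The top \<open>x n\<close> is an \<open>R\<close>-successor of
          \<open>w\<close>, and every lower \<open>x i\<close> is one of
          \<open>x (Suc i)\<close>.\<close>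
        using chain(1) wa a R_worlds by (cases "i = n") auto
    qed
    have D: "\<forall>i\<in>{1..<n}. \<forall>u. (x i, u) \<in> R \<and> u \<in> T (D i) \<longrightarrow>
        (\<exists>V. (u, V) \<in> S (x i) \<and> V \<subseteq> T (D (Suc i)))"
    proof
      fix i
      assume "i \<in> {1..<n}"
      then show "\<forall>u. (x i, u) \<in> R \<and> u \<in> T (D i) \<longrightarrow>
        (\<exists>V. (u, V) \<in> S (x i) \<and> V \<subseteq> T (D (Suc i)))"
        using rhd[of "x i" "D i" "D (Suc i)"] wit xW unfolding U_witness_def by simp
    qed
    have C: "\<forall>V. (z, V) \<in> S y \<longrightarrow> V \<inter> T C \<noteq> {}"
      using wit S_worlds[OF yz(1)] unfolding U_witness_def T_def by blast
    have z: "z \<in> T (D 1)"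
      using wit yz by (simp add: U_witness_def T_def)
    have an: "(w, x n) \<in> R" and anW: "x n \<in> W" and DAn: "forces R S val (x n) (D n \<^bold>\<rhd> A)"
      using wa a DA R_worlds by auto
    \<comment> \<open>The last inclusion is what turns into \<open>Box C\<close> at every element of
      \<open>V\<close>.\<close>
    have "\<exists>V. V \<subseteq> T B \<and> (x n, V) \<in> S w \<and> {t. \<exists>v\<in>V. (v, t) \<in> R} \<subseteq> T C"
      using gen[unfolded R_gen_def, THEN bspec, OF w, THEN spec, THEN mp, OF xW, THEN bspec,
          OF yz(1), THEN bspec, OF yz(2), THEN spec, of "T A", THEN spec, of "T B", THEN spec,
          of "T C", THEN spec, of "\<lambda>i. T (D i)", THEN mp, THEN mp, THEN mp, OF _ _ rhd[OF w AB],
          THEN mp, OF _ _ rhd[OF anW DAn], THEN mp, OF _ _ D, THEN mp, OF _ _ C, THEN mp, OF _ _ z]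
        T_sub an chain
      by blast
    then show ?thesis
      using a by (fastforce simp: T_def)
  qed
  then show "forces R S val w (R_scheme n A B C D)"
    by (simp add: R_scheme_def)
qed

lemma R_gen_complete:
  assumes "n \<ge> 1" and valid: "\<And>A B C D. frame_valid W R S (R_scheme n A B C D)"
  shows "R_gen n W R S"
  unfolding R_gen_def
proof (intro ballI allI impI, elim conjE)
  fix w x y z \<A> \<B> \<C> \<D>
  assume w: "w \<in> W"
    and sub: "\<A> \<subseteq> W" "\<B> \<subseteq> W" "\<C> \<subseteq> W" "\<forall>i\<in>{1..n}. \<D> i \<subseteq> W"
    and chain: "(w, x n) \<in> R" "\<forall>i\<in>{1..<n}. (x (Suc i), x i) \<in> R" "(x 1, y) \<in> R" "(y, z) \<in> R"
    and AB: "\<forall>u. (w, u) \<in> R \<and> u \<in> \<A> \<longrightarrow> (\<exists>V. (u, V) \<in> S w \<and> V \<subseteq> \<B>)"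
    and DA: "\<forall>u. (x n, u) \<in> R \<and> u \<in> \<D> n \<longrightarrow> (\<exists>V. (u, V) \<in> S (x n) \<and> V \<subseteq> \<A>)"
    and DD: "\<forall>i\<in>{1..<n}. \<forall>u. (x i, u) \<in> R \<and> u \<in> \<D> i \<longrightarrow>
        (\<exists>V. (u, V) \<in> S (x i) \<and> V \<subseteq> \<D> (Suc i))"
    and C: "\<forall>V. (z, V) \<in> S y \<longrightarrow> V \<inter> \<C> \<noteq> {}"
    and z: "z \<in> \<D> 1"
  \<comment> \<open>The shift by 3 reserves the variables 0, 1 and 2 for \<A>, \<B> and
    \<C>.\<close>
  define D where "D = (\<lambda>i. Var (i + 3))"
  \<comment> \<open>Since \<open>\<D> i \<subseteq> W\<close> is given only for \<open>i\<close> in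
    \<open>{1..n}\<close>, the remaining variables get the empty set, which keeps \<open>val\<close>
    within \<open>W\<close>.\<close>
  define val where "val = (\<lambda>p. if p = 0 then \<A> else if p = 1 then \<B> else if p = 2 then \<C>
    else if p - 3 \<in> {1..n} then \<D> (p - 3) else {})"
  have val_sub: "\<forall>p. val p \<subseteq> W"
    using sub unfolding val_def by simp
  have val_simps: "val 0 = \<A>" "val (Suc 0) = \<B>" "val 2 = \<C>"
    "\<And>i. i \<in> {1..n} \<Longrightarrow> val (i + 3) = \<D> i"
    by (auto simp: val_def)
  have fD: "forces R S val v (D i) \<longleftrightarrow> v \<in> \<D> i" if "i \<in> {1..n}" for v i
    using val_simps(4)[OF that] by (simp add: D_def)
  have "forces R S val (x i) (D i \<^bold>\<rhd> D (Suc i))" if "i \<in> {1..<n}" for i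
  proof -
    \<comment> \<open>Both indices must lie in the range where \<open>val\<close> agrees with
      \<D>.\<close>
    have "i \<in> {1..n}" "Suc i \<in> {1..n}"
      using that by auto
    then show ?thesis
      using DD that by (simp add: fD subset_eq)
  qed
  moreover have "forces R S val z (D 1)"
    using z fD[of 1] \<open>n \<ge> 1\<close> by simp
  moreover have "\<forall>V. (z, V) \<in> S y \<longrightarrow> (\<exists>v\<in>V. forces R S val v (Var 2))"
    using C unfolding forces.simps val_simps by blast
  ultimately have "U_witness R S val D (Var 2) n x y z"
    using chain by (simp add: U_witness_def del: forces.simps)
  then have "forces R S val (x n) (U D (Var 2) n)"
    unfolding forces_U[OF \<open>n \<ge> 1\<close>] by (intro exI[of _ x] exI[of _ y] exI[of _ z] conjI refl)
  moreover have "forces R S val (x n) (D n \<^bold>\<rhd> Var 0)"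
    using DA \<open>n \<ge> 1\<close> by (auto simp: fD val_simps subset_eq)
  moreover have "forces R S val w (Var 0 \<^bold>\<rhd> Var 1)"
    using AB by (auto simp: val_simps subset_eq)
  moreover have "forces R S val w (R_scheme n (Var 0) (Var 1) (Var 2) D)"
    using valid val_sub w unfolding frame_valid_def by blast
  ultimately obtain V where "(x n, V) \<in> S w"
    "\<forall>v\<in>V. forces R S val v (Var 1 \<^bold>\<and> \<^bold>\<box>(Var 2))"
    \<comment> \<open>Unfolding \<open>\<rhd>\<close> only where its left side is a conjunction
      opens the outer formula of the scheme and leaves \<open>Var 0 \<rhd> Var 1\<close> and
      \<open>D n \<rhd> Var 0\<close> in the form of the facts above.\<close>
    using chain(1) unfolding R_scheme_def forces.simps(3) forces.simps(5)[of _ _ _ _ "_ \<^bold>\<and> _"]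
      forces_Conj by blast
  then show "\<exists>V. V \<subseteq> \<B> \<and> (x n, V) \<in> S w \<and> {t. \<exists>v\<in>V. (v, t) \<in> R} \<subseteq> \<C>"
    by (auto simp: val_simps)
qed

end

theorem theorem8p3:
  fixes n :: nat
    and W :: "'w set"
    and R :: "('w \<times> 'w) set"
    and S :: "'w \<Rightarrow> ('w \<times> 'w set) set"
  assumes "n \<ge> 1"
    and "generalised_Veltman_frame W R S"
  shows "R_gen n W R S \<longleftrightarrow> (\<forall>A B C D. frame_valid W R S (R_scheme n A B C D))"
  using generalised_Veltman_frame.R_gen_sound[OF assms(2,1)]
    generalised_Veltman_frame.R_gen_complete[OF assms(2,1)]
  by blast

end
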